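(* For all $(J,E)\in D$ one has $\Delta(J,E)>0$, where $$\Delta(J,E)=\det\begin{pmatrix}\frac{\partial T}{\partial E}&\frac{\partial\Psi}{\partial E}\\[1mm]\frac{\partial T}{\partial J}&\frac{\partial\Psi}{\partial J}\end{pmatrix}(J,E).$$
   Context: The setting is the solutions of $W_{xx}+W+|W|^2W=0$ ($W:\mathbb{R}\to\mathbb{C}$), with conserved quantities $J=\mathrm{Im}(\overline{W}W_x)$ and $E=\frac12|W_x|^2+\frac12|W|^2+\frac14|W|^4$. For $J\in\mathbb{R}$ write $J=q(q^2-1)$ with $q\in\mathbb{R}$, $|q|\ge1$, and set $E_-(J)=\frac14(q^2-1)(3q^2+1)$. Let $D=\{(J,E)\in\mathbb{R}^2\mid E>E_-(J)\}$. For $(J,E)\in D$ let $y_3<0\le y_1<y_2$ be the roots of $P(y)=-y^3-2y^2+4Ey-2J^2$ and $s(\varphi)=y_1\cos^2\varphi+y_2\sin^2\varphi$. The period of $|W|$ and the phase increment of $W$ over this period are $$T(J,E)=2\sqrt2\int_0^{\pi/2}\frac{d\varphi}{\sqrt{s(\varphi)-y_3}},\qquad \Phi(J,E)=2\sqrt2\int_0^{\pi/2}\frac{J}{s(\varphi)}\frac{d\varphi}{\sqrt{s(\varphi)-y_3}}\quad(J\ne0).$$ The renormalized phase is $\Psi(J,E)=\Phi(J,E)-\pi\,\mathrm{sign}(J)$ for $J\neq0$ and $\Psi(0,E)=0$; equivalently, on all of $D$, $$\Psi(J,E)=-2\sqrt2\,J\int_0^{\pi/2}\frac{d\varphi}{\sqrt{-y_3}\,\sqrt{s(\varphi)-y_3}\,(\sqrt{-y_3}+\sqrt{s(\varphi)-y_3})}.$$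 *)

theory Defs
  imports "HOL-Analysis.Analysis"
begin

text \<open>
  The lemmas after the definitions of \<open>E_minus\<close> and \<open>roots\<close> show that the choice operators occurring
  there do pick out the intended objects.
\<close>

definition E_minus :: "real \<Rightarrow> real" where
  "E_minus J = (let q = (SOME q. \<bar>q\<bar> \<ge> 1 \<and> J = q * (q^2 - 1))
                in 1/4 * (q^2 - 1) * (3 * q^2 + 1))"

definition D :: "(real \<times> real) set" where
  "D = {(J, E). E > E_minus J}"

definition P :: "real \<Rightarrow> real \<Rightarrow> real \<Rightarrow> real" where
  "P J E y = - (y^3) - 2 * y^2 + 4 * E * y - 2 * J^2"

definition roots :: "real \<Rightarrow> real \<Rightarrow> real \<times> real \<times> real" where
  "roots J E = (THE (y1, y2, y3). y3 < 0 \<and> 0 \<le> y1 \<and> y1 < y2 \<and>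
                  P J E y1 = 0 \<and> P J E y2 = 0 \<and> P J E y3 = 0)"

definition y1 :: "real \<Rightarrow> real \<Rightarrow> real" where "y1 J E = fst (roots J E)"
definition y2 :: "real \<Rightarrow> real \<Rightarrow> real" where "y2 J E = fst (snd (roots J E))"
definition y3 :: "real \<Rightarrow> real \<Rightarrow> real" where "y3 J E = snd (snd (roots J E))"

definition s :: "real \<Rightarrow> real \<Rightarrow> real \<Rightarrow> real" where
  "s J E \<phi> = y1 J E * (cos \<phi>)^2 + y2 J E * (sin \<phi>)^2"

definition T :: "real \<Rightarrow> real \<Rightarrow> real" where
  "T J E = 2 * sqrt 2 * integral {0..pi/2} (\<lambda>\<phi>. 1 / sqrt (s J E \<phi> - y3 J E))"

text \<open>Only meaningful for \<open>J \<noteq> 0\<close>.\<close>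

definition Phi :: "real \<Rightarrow> real \<Rightarrow> real" where
  "Phi J E = 2 * sqrt 2 *
     integral {0..pi/2} (\<lambda>\<phi>. J / s J E \<phi> * (1 / sqrt (s J E \<phi> - y3 J E)))"

definition Psi :: "real \<Rightarrow> real \<Rightarrow> real" where
  "Psi J E = (if J = 0 then 0 else Phi J E - pi * sgn J)"

definition Delta :: "real \<Rightarrow> real \<Rightarrow> real" where
  "Delta J E = det (vector
     [vector [deriv (\<lambda>e. T J e) E, deriv (\<lambda>e. Psi J e) E],
      vector [deriv (\<lambda>j. T j E) J, deriv (\<lambda>j. Psi j E) J]] :: real^2^2)"


lemma q_exists:
  fixes J :: real
  shows "\<exists>q. \<bar>q\<bar> \<ge> 1 \<and> J = q * (q^2 - 1)"
proof -
  have *: "\<exists>q\<ge>1. q * (q^2 - 1) = K" if "K \<ge> 0" for K :: real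
  proof -
    have "K \<le> (1 + K) * ((1 + K)^2 - 1)"
      using that by (simp add: power2_eq_square algebra_simps)
    moreover have "continuous_on {1..1 + K} (\<lambda>q. q * (q^2 - 1))"
      by (intro continuous_intros)
    ultimately show ?thesis
      using IVT'[of "\<lambda>q. q * (q^2 - 1)" 1 K "1 + K"] that by auto
  qed
  show ?thesis
  proof (cases "J \<ge> 0")
    case True
    then obtain q where "q \<ge> 1" "q * (q^2 - 1) = J" using * by blast
    then show ?thesis by (intro exI[of _ q]) auto
  next
    case False
    then obtain q where q: "q \<ge> 1" "q * (q^2 - 1) = - J" using *[of "- J"] by auto
    then have "J = - q * ((- q)^2 - 1)" by simp
    then show ?thesis using q(1) by (intro exI[of _ "- q"]) auto
  qed
qed

lemma q_square_unique:
  fixes q r :: real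
  assumes "\<bar>q\<bar> \<ge> 1" "\<bar>r\<bar> \<ge> 1" "q * (q^2 - 1) = r * (r^2 - 1)"
  shows "q^2 = r^2"
proof -
  have *: False if "x^2 < y^2" "\<bar>x\<bar> \<ge> 1" "x * (x^2 - 1) = y * (y^2 - 1)" for x y :: real
  proof -
    have "x^2 \<ge> 1" using that(2) by (simp add: abs_le_square_iff[of 1, simplified])
    moreover have "x^2 * (x^2 - 1)^2 = y^2 * (y^2 - 1)^2"
      using arg_cong[OF that(3), of "\<lambda>z. z^2"] by (simp add: power_mult_distrib)
    moreover have "x^2 * (x^2 - 1)^2 < y^2 * (y^2 - 1)^2"
      using calculation(1) that(1) power_strict_mono[of "x^2 - 1" "y^2 - 1" 2]
      by (intro mult_strict_mono) auto
    ultimately show False by simp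
  qed
  show ?thesis using *[of q r] *[of r q] assms by (cases "q^2" "r^2" rule: linorder_cases) auto
qed

lemma E_minus_eq:
  assumes "\<bar>q\<bar> \<ge> 1"
  shows "E_minus (q * (q^2 - 1)) = 1/4 * (q^2 - 1) * (3 * q^2 + 1)"
proof -
  define r where "r = (SOME r. \<bar>r\<bar> \<ge> 1 \<and> q * (q^2 - 1) = r * (r^2 - 1))"
  have "\<bar>r\<bar> \<ge> 1 \<and> q * (q^2 - 1) = r * (r^2 - 1)"
    unfolding r_def by (rule someI[of _ q]) (use assms in simp)
  then have "r^2 = q^2" using q_square_unique[OF _ assms, of r] by metis
  then show ?thesis unfolding E_minus_def Let_def r_def[symmetric] by metis
qed

lemma roots_eq:
  assumes "c < 0" "0 \<le> a" "a < b" "P J E a = 0" "P J E b = 0" "P J E c = 0"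
  shows "roots J E = (a, b, c)"
proof -
  have fac: "P J E y = - (y - a) * (y - b) * (y - c)" for y
  proof -
    have "(a - b) * (- (a^2 + a*b + b^2) - 2 * (a + b) + 4 * E) = P J E a - P J E b"
      unfolding P_def by algebra
    then have 1: "4 * E = a^2 + a*b + b^2 + 2 * (a + b)" using assms by simp
    have "(b - c) * (- (b^2 + b*c + c^2) - 2 * (b + c) + 4 * E) = P J E b - P J E c"
      unfolding P_def by algebra
    then have 2: "4 * E = b^2 + b*c + c^2 + 2 * (b + c)" using assms by simp
    have "(a - c) * (a + b + c + 2) = 0" using 1 2 by algebra
    then have 3: "c = - 2 - a - b" using assms by simp
    have 4: "2 * J^2 = - (a^3) - 2 * a^2 + 4 * E * a" using assms(4) unfolding P_def by simp
    show ?thesis unfolding P_def 4 1 3 by algebra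
  qed
  show ?thesis unfolding roots_def
  proof (rule the_equality)
    show "case (a, b, c) of (u, v, w) \<Rightarrow> w < 0 \<and> 0 \<le> u \<and> u < v \<and>
                  P J E u = 0 \<and> P J E v = 0 \<and> P J E w = 0"
      using assms by simp
  next
    fix t
    assume t: "case t of (u, v, w) \<Rightarrow> w < 0 \<and> 0 \<le> u \<and> u < v \<and>
                  P J E u = 0 \<and> P J E v = 0 \<and> P J E w = 0"
    obtain x y z where [simp]: "t = (x, y, z)" by (cases t) auto
    show "t = (a, b, c)" using t assms(1-3) by (auto simp: fac)
  qed
qed

lemma roots_exist:
  assumes "(J, E) \<in> D"
  shows "\<exists>a b c. c < 0 \<and> 0 \<le> a \<and> a < b \<and> P J E a = 0 \<and> P J E b = 0 \<and> P J E c = 0"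
proof -
  obtain q where q: "\<bar>q\<bar> \<ge> 1" "J = q * (q^2 - 1)" using q_exists by blast
  define m where "m = q^2 - 1"
  have m0: "m \<ge> 0" using q(1) by (simp add: m_def abs_le_square_iff[of 1, simplified])
  have Em: "E > 1/4 * m * (3 * m + 4)"
    using assms E_minus_eq[OF q(1)] q(2) unfolding D_def m_def by (simp add: algebra_simps)
  then have E0: "E > 0" using m0 by (smt (verit) mult_nonneg_nonneg divide_nonneg_nonneg)
  have J2: "J^2 = (m + 1) * m^2" unfolding q(2) m_def by algebra
  show ?thesis
  proof (cases "m = 0")
    case True
    then have J: "J = 0" using J2 by simp
    define w where "w = sqrt (1 + 4 * E)"
    have w: "w > 1" "w^2 = 1 + 4 * E" using E0 by (auto simp: w_def)
    have "P J E (w - 1) = (w - 1) * (1 + 4 * E - w^2)"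
      "P J E (- w - 1) = (- w - 1) * (1 + 4 * E - w^2)"
      unfolding P_def J by (simp_all add: power2_eq_square power3_eq_cube algebra_simps)
    then have "P J E (w - 1) = 0" "P J E (- w - 1) = 0" using w(2) by simp_all
    moreover have "P J E 0 = 0" by (simp add: P_def J)
    moreover have "- w - 1 < 0" "0 < w - 1" using w(1) by simp_all
    ultimately show ?thesis by blast
  next
    case False
    then have mp: "m > 0" using m0 by simp
    have cont: "continuous_on S (P J E)" for S
      unfolding P_def by (intro continuous_intros)
    have "P J E m = m * (4 * E - m * (3 * m + 4))"
      unfolding P_def J2 by algebra
    then have Pm: "P J E m > 0" using Em mp by simp
    have P0: "P J E 0 < 0" using J2 mp by (simp add: P_def)
    define M where "M = m + 4 * E + 1"
    have "M^2 \<ge> 4 * E"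
    proof -
      have "M * M \<ge> M * 1" unfolding M_def using mp E0 by (intro mult_left_mono) auto
      then show ?thesis using mp by (simp add: power2_eq_square M_def)
    qed
    then have "M * (4 * E - M^2) \<le> 0" using mp E0 by (intro mult_nonneg_nonpos) (auto simp: M_def)
    moreover have "P J E M = M * (4 * E - M^2) - 2 * M^2 - 2 * J^2" unfolding P_def by algebra
    moreover have "M^2 > 0" using mp E0 by (simp add: M_def)
    ultimately have PM: "P J E M < 0" by (smt (verit) zero_le_power2)
    define N where "N = 4 + 4 * E + 2 * J^2"
    have N: "N \<ge> 4" "N \<ge> 4 * E + 4" "N \<ge> 2 * J^2" using E0 by (auto simp: N_def)
    have "N * (N - 2) \<ge> N * 2" using N by (intro mult_left_mono) auto
    then have "N * (N - 2) - 4 * E \<ge> 1" using N E0 by linarith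
    then have "N * (N * (N - 2) - 4 * E) \<ge> N * 1" using N by (intro mult_left_mono) auto
    moreover have "P J E (- N) = N * (N * (N - 2) - 4 * E) - 2 * J^2" unfolding P_def by algebra
    ultimately have PN: "P J E (- N) \<ge> 0" using N by linarith
    obtain a where a: "0 \<le> a" "a \<le> m" "P J E a = 0"
      using IVT'[of "P J E" 0 0 m] P0 Pm mp cont by force
    obtain b where b: "m \<le> b" "b \<le> M" "P J E b = 0"
      using IVT2'[of "P J E" M 0 m] PM Pm mp E0 cont by (force simp: M_def)
    obtain c where c: "- N \<le> c" "c \<le> 0" "P J E c = 0"
      using IVT2'[of "P J E" 0 0 "- N"] PN P0 N cont by force
    have "c \<noteq> 0" "a \<noteq> m" using c P0 a Pm by auto
    then show ?thesis using a b c by (intro exI[of _ a] exI[of _ b] exI[of _ c]) auto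
  qed
qed

lemma roots_D:
  assumes "(J, E) \<in> D"
  shows "y3 J E < 0" "0 \<le> y1 J E" "y1 J E < y2 J E"
    "P J E (y1 J E) = 0" "P J E (y2 J E) = 0" "P J E (y3 J E) = 0"
proof -
  obtain a b c where *: "c < 0" "0 \<le> a" "a < b" "P J E a = 0" "P J E b = 0" "P J E c = 0"
    using roots_exist[OF assms] by blast
  then have "roots J E = (a, b, c)" by (rule roots_eq)
  then show "y3 J E < 0" "0 \<le> y1 J E" "y1 J E < y2 J E"
    "P J E (y1 J E) = 0" "P J E (y2 J E) = 0" "P J E (y3 J E) = 0"
    using * by (simp_all add: y1_def y2_def y3_def)
qed

end

theory Submission
  imports Defs
begin

text \<open>
  With \<open>m = (y1 + y2) / 2\<close> and \<open>d = (y2 - y1) / 2\<close> the relations between the roots become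
  \<open>y3 = - 2 - 2 m\<close>, \<open>4 E = 3 m\<^sup>2 + 4 m + d\<^sup>2\<close>, \<open>J\<^sup>2 = (m\<^sup>2 - d\<^sup>2) (1 + m)\<close>, and both \<open>T\<close> and
  \<open>Psi / J\<close> are integrals of a kernel \<open>f m x\<close> along \<open>x = 2 + 3 m - d cos (2 \<phi>)\<close>. Along each of the
  curves \<open>J = const\<close> and \<open>E = const\<close>, parametrized by \<open>m\<close>, an integration by parts removes the
  factor \<open>1 / d\<close> from the derivative of such an integral and leaves the integrand
  \<open>f\<^sub>m + 3 f\<^sub>x + d d' f\<^sub>x\<^sub>x sin\<^sup>2 (2 \<phi>)\<close>. Since \<open>x \<ge> 2 + 2 m\<close>, its sign can be read off pointwise:
  \<open>T\<^sub>E < 0\<close>, \<open>Psi\<^sub>J < 0\<close>, while \<open>T\<^sub>J\<close> has the sign of \<open>- J\<close> and \<open>Psi\<^sub>E\<close> that of \<open>J\<close>. Hence both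
  terms of \<open>T\<^sub>E Psi\<^sub>J - Psi\<^sub>E T\<^sub>J\<close> are nonnegative and the first is positive.
\<close>

section \<open>The cubic in terms of the midpoint and half-distance of its two larger roots\<close>

definition mid :: "real \<Rightarrow> real \<Rightarrow> real" where "mid J E = (y1 J E + y2 J E) / 2"
definition rad :: "real \<Rightarrow> real \<Rightarrow> real" where "rad J E = (y2 J E - y1 J E) / 2"

text \<open>These are Vieta's relations. Dividing the difference of \<open>P\<close> at two roots by
  the difference of the roots gives \<open>E\<close> and then the sum of the roots; inserting both
  into \<open>P J E a = 0\<close> gives \<open>J^2\<close>.\<close>

lemma D_mid_rad:
  assumes "(J, E) \<in> D"
  shows "0 < rad J E" "rad J E \<le> mid J E" "y3 J E = - 2 - 2 * mid J E"
    "4 * E = 3 * (mid J E)^2 + 4 * mid J E + (rad J E)^2"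
    "J^2 = ((mid J E)^2 - (rad J E)^2) * (1 + mid J E)"
proof -
  note r = roots_D[OF assms]
  define a b c where "a = y1 J E" "b = y2 J E" "c = y3 J E"
  note abc = a_b_c_def
  have m: "mid J E = (a + b) / 2" and d: "rad J E = (b - a) / 2"
    by (simp_all add: mid_def rad_def abc)
  have o: "c < 0" "0 \<le> a" "a < b" and z: "P J E a = 0" "P J E b = 0" "P J E c = 0"
    using r by (simp_all add: abc)
  have "(a - b) * (- (a^2 + a*b + b^2) - 2 * (a + b) + 4 * E) = P J E a - P J E b"
    unfolding P_def by algebra
  then have 1: "4 * E = a^2 + a*b + b^2 + 2 * (a + b)" using o z by simp
  have "(b - c) * (- (b^2 + b*c + c^2) - 2 * (b + c) + 4 * E) = P J E b - P J E c"
    unfolding P_def by algebra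
  then have 2: "4 * E = b^2 + b*c + c^2 + 2 * (b + c)" using o z by simp
  have "(a - c) * (a + b + c + 2) = 0" using 1 2 by algebra
  then have 3: "c = - 2 - a - b" using o by simp
  have 4: "2 * J^2 = - (a^3) - 2 * a^2 + (4 * E) * a" using z unfolding P_def by simp
  show "0 < rad J E" "rad J E \<le> mid J E" using o by (auto simp: m d)
  have "y3 J E = - 2 - (a + b)" using 3 abc(3) by simp
  then show "y3 J E = - 2 - 2 * mid J E" using m by simp
  show "4 * E = 3 * (mid J E)^2 + 4 * mid J E + (rad J E)^2"
    unfolding 1 m d by (simp add: power2_eq_square field_simps)
  show "J^2 = ((mid J E)^2 - (rad J E)^2) * (1 + mid J E)"
    using 4 unfolding 1 m d by (simp add: power2_eq_square power3_eq_cube field_simps)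
qed

text \<open>This replaces the choice of \<open>q\<close> by a strict inequality that is continuous
  in \<open>J\<close> and \<open>E\<close> for fixed \<open>y\<close>, so that openness becomes
  immediate. The witness for the forward direction is the midpoint \<open>mid J E\<close>, which
  lies strictly between the two larger roots.\<close>

lemma mem_D_iff: "(J, E) \<in> D \<longleftrightarrow> (\<exists>y>0. P J E y > 0)"
proof
  assume D: "(J, E) \<in> D"
  let ?m = "mid J E" and ?d = "rad J E"
  note h = D_mid_rad[OF D]
  have "P J E ?m = - (?m^3) - 2 * ?m^2 + (4 * E) * ?m - 2 * J^2" by (simp add: P_def)
  also have "\<dots> = ?d^2 * (2 + 3 * ?m)"
    unfolding h(4,5) by algebra
  finally show "\<exists>y>0. P J E y > 0" using h(1,2) by (intro exI[of _ ?m]) auto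
next
  assume "\<exists>y>0. P J E y > 0"
  then obtain y where y: "y > 0" "P J E y > 0" by blast
  obtain q where q: "\<bar>q\<bar> \<ge> 1" "J = q * (q^2 - 1)" using q_exists by blast
  define n where "n = q^2 - 1"
  have n0: "n \<ge> 0" using q(1) by (simp add: n_def abs_le_square_iff[of 1, simplified])
  have J2: "J^2 = (n + 1) * n^2" unfolding q(2) n_def by algebra
  \<comment> \<open>For the boundary value of \<open>E\<close> the number \<open>n\<close> is a
    double root of \<open>P\<close>, and the remaining root is \<open>- 2 * n - 2\<close>; the
    square is what remains of \<open>P\<close> there, and the other term measures the excess of
    \<open>E\<close> over the boundary value.\<close>
  have "0 < y * (4 * E - n * (3 * n + 4)) - (y - n)^2 * (y + 2 * n + 2)"
    using y(2) unfolding P_def J2 by (simp add: algebra_simps power2_eq_square power3_eq_cube)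
  moreover have "(y - n)^2 * (y + 2 * n + 2) \<ge> 0" using y n0 by simp
  ultimately have "0 < y * (4 * E - n * (3 * n + 4))" by linarith
  then have "E > 1/4 * n * (3 * n + 4)" using y(1) by (simp add: zero_less_mult_iff)
  moreover have "E_minus J = 1/4 * n * (3 * n + 4)"
    using E_minus_eq[OF q(1)] unfolding q(2)[symmetric] n_def by simp
  ultimately show "(J, E) \<in> D" unfolding D_def by simp
qed

lemma D_open_sections:
  assumes "(J, E) \<in> D"
  shows "\<forall>\<^sub>F e in nhds E. (J, e) \<in> D" "\<forall>\<^sub>F j in nhds J. (j, E) \<in> D"
proof -
  obtain y where y: "y > 0" "P J E y > 0" using assms mem_D_iff by blast
  have "((\<lambda>e. P J e y) \<longlongrightarrow> P J E y) (nhds E)" "((\<lambda>j. P j E y) \<longlongrightarrow> P J E y) (nhds J)"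
    unfolding P_def by (intro tendsto_intros filterlim_ident)+
  then have "\<forall>\<^sub>F e in nhds E. P J e y > 0" "\<forall>\<^sub>F j in nhds J. P j E y > 0"
    using y(2) by (auto dest: order_tendstoD)
  then show "\<forall>\<^sub>F e in nhds E. (J, e) \<in> D" "\<forall>\<^sub>F j in nhds J. (j, E) \<in> D"
    using y(1) by (auto elim!: eventually_mono simp: mem_D_iff)
qed

section \<open>Differentiability of \<open>mid\<close> along the two coordinate directions\<close>

text \<open>An implicit function theorem for equations already in factored difference form. The
  bound \<open>Q (m u) \<ge> 1\<close> gives
  \<open>\<bar>m u - m t\<bar> \<le> \<bar>k u - k t\<bar>\<close>, hence continuity of
  \<open>m\<close> at \<open>t\<close>; the difference quotient of \<open>m\<close> is then that of
  \<open>k\<close> divided by \<open>Q (m u)\<close>.\<close>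

lemma implicit_has_real_derivative:
  fixes m Q k :: "real \<Rightarrow> real"
  assumes eq: "\<forall>\<^sub>F u in nhds t. (m u - m t) * Q (m u) = k u - k t \<and> Q (m u) \<ge> 1"
    and Q: "isCont Q (m t)" and k: "(k has_real_derivative k') (at t)"
  shows "(m has_real_derivative k' / Q (m t)) (at t)"
proof -
  have eq': "\<forall>\<^sub>F u in at t. (m u - m t) * Q (m u) = k u - k t \<and> Q (m u) \<ge> 1"
    using eq by (simp add: eventually_nhds_conv_at)
  have Qt: "Q (m t) \<ge> 1" using eventually_nhds_x_imp_x[OF eq] by simp
  have "isCont k t" using k by (rule DERIV_isCont)
  then have "((\<lambda>u. \<bar>k u - k t\<bar>) \<longlongrightarrow> 0) (at t)"
    by (simp add: isCont_def LIM_zero tendsto_rabs_zero)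
  moreover have "\<forall>\<^sub>F u in at t. norm (m u - m t) \<le> \<bar>k u - k t\<bar>"
    using eq'
  proof eventually_elim
    case (elim u)
    have "\<bar>m u - m t\<bar> * 1 \<le> \<bar>m u - m t\<bar> * Q (m u)" using elim by (intro mult_left_mono) auto
    also have "\<dots> = \<bar>k u - k t\<bar>" using elim by (metis abs_mult abs_of_nonneg dual_order.trans zero_le_one)
    finally show ?case by simp
  qed
  ultimately have "((\<lambda>u. m u - m t) \<longlongrightarrow> 0) (at t)" by (rule Lim_null_comparison[rotated])
  then have "(m \<longlongrightarrow> m t) (at t)" by (simp add: LIM_zero_iff)
  then have "((\<lambda>u. Q (m u)) \<longlongrightarrow> Q (m t)) (at t)" using Q by (rule isCont_tendsto_compose[rotated])
  then have "((\<lambda>u. (k u - k t) / (u - t) / Q (m u)) \<longlongrightarrow> k' / Q (m t)) (at t)"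
    using k Qt by (intro tendsto_divide) (auto simp: has_field_derivative_iff)
  moreover have "\<forall>\<^sub>F u in at t. (k u - k t) / (u - t) / Q (m u) = (m u - m t) / (u - t)"
    using eq'
  proof eventually_elim
    case (elim u)
    then have "k u - k t = (m u - m t) * Q (m u)" "Q (m u) \<noteq> 0" by auto
    then show ?case by simp
  qed
  ultimately show ?thesis unfolding has_field_derivative_iff by (rule Lim_transform_eventually)
qed

text \<open>Eliminating \<open>rad\<close> from the root relations gives
  \<open>e = m^2 + m - J^2 / (4 * (1 + m))\<close>, and \<open>?Q\<close> is the difference quotient
  in \<open>m\<close> of the right-hand side. The derivative enters the determinant only as a
  positive factor.\<close>

lemma mid_deriv_E:
  assumes "(J, E) \<in> D"
  obtains m' where "m' > 0" "((\<lambda>e. mid J e) has_real_derivative m') (at E)"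
proof -
  let ?m = "\<lambda>e. mid J e"
  let ?Q = "\<lambda>v. v + ?m E + 1 + J^2 / (4 * (1 + ?m E) * (1 + v))"
  have *: "(?m e > 0) \<and> e = (?m e)^2 + ?m e - J^2 / (4 * (1 + ?m e))" if "(J, e) \<in> D" for e
  proof -
    note h = D_mid_rad[OF that]
    have 0: "?m e > 0" using h by linarith
    then have "J^2 / (1 + ?m e) = (?m e)^2 - (rad J e)^2" using h(5) by simp
    then have "J^2 / (4 * (1 + ?m e)) = ((?m e)^2 - (rad J e)^2) / 4"
      by (metis divide_divide_eq_left mult.commute)
    then have "e = (?m e)^2 + ?m e - J^2 / (4 * (1 + ?m e))" using h(4) by simp
    then show ?thesis using 0 by blast
  qed
  have m0: "?m E > 0" using *[OF assms] by simp
  have "(?m e - ?m E) * ?Q (?m e) = e - E \<and> ?Q (?m e) \<ge> 1" if "(J, e) \<in> D" for e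
  proof
    have me: "?m e > 0" using *[OF that] by simp
    have "J^2 / (4 * (1 + ?m E)) - J^2 / (4 * (1 + ?m e)) = (?m e - ?m E) * (J^2 / (4 * (1 + ?m E) * (1 + ?m e)))"
      using me m0 by (simp add: divide_simps) (simp add: algebra_simps)
    moreover have "e - E = (?m e)^2 - (?m E)^2 + ?m e - ?m E + (J^2 / (4 * (1 + ?m E)) - J^2 / (4 * (1 + ?m e)))"
      using *[OF that] *[OF assms] by linarith
    ultimately show "(?m e - ?m E) * ?Q (?m e) = e - E"
      by (simp add: algebra_simps power2_eq_square)
    show "?Q (?m e) \<ge> 1" using me m0 by simp
  qed
  then have ev: "\<forall>\<^sub>F e in nhds E. (?m e - ?m E) * ?Q (?m e) = e - E \<and> ?Q (?m e) \<ge> 1"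
    using D_open_sections(1)[OF assms] by (auto elim: eventually_mono)
  have "isCont ?Q (?m E)" using m0 by (intro continuous_intros) auto
  then have "(?m has_real_derivative 1 / ?Q (?m E)) (at E)"
    by (rule implicit_has_real_derivative[where m = ?m and t = E and Q = ?Q and k = "\<lambda>e. e" and k' = 1,
          OF ev _ DERIV_ident])
  moreover have "1 / ?Q (?m E) > 0" using m0 by (simp add: add_pos_nonneg)
  ultimately show ?thesis using that by blast
qed

text \<open>For fixed \<open>E\<close>, eliminating \<open>rad\<close> gives
  \<open>j^2 / 4 = (1 + m) * (m^2 + m - E)\<close>, and \<open>?Q\<close> is the difference quotient
  in \<open>m\<close> of the right-hand side. It is at least 1 because
  \<open>E \<le> m^2 + m\<close>.\<close>

lemma mid_deriv_J:
  assumes "(J, E) \<in> D"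
  shows "((\<lambda>j. mid j E) has_real_derivative 2 * J / ((2 + 3 * mid J E)^2 - (rad J E)^2)) (at J)"
proof -
  let ?m = "\<lambda>j. mid j E"
  let ?Q = "\<lambda>v. v^2 + v * ?m J + (?m J)^2 + 2 * (v + ?m J) + 1 - E"
  have *: "?m j > 0 \<and> E \<le> (?m j)^2 + ?m j \<and> j^2 / 4 = (1 + ?m j) * ((?m j)^2 + ?m j - E)"
    if "(j, E) \<in> D" for j
  proof -
    note h = D_mid_rad[OF that]
    have 0: "?m j > 0" using h by linarith
    have "(rad j E)^2 \<le> (?m j)^2" using h by (intro power_mono) auto
    moreover have eq: "(?m j)^2 + ?m j - E = ((?m j)^2 - (rad j E)^2) / 4" using h(4) by (simp add: field_simps)
    ultimately have "E \<le> (?m j)^2 + ?m j" using zero_le_divide_iff[of "(?m j)^2 - (rad j E)^2" 4] by simp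
    moreover have "j^2 / 4 = (1 + ?m j) * ((?m j)^2 + ?m j - E)" unfolding eq h(5) by simp
    ultimately show ?thesis using 0 by blast
  qed
  note m0 = *[OF assms]
  have "(?m j - ?m J) * ?Q (?m j) = j^2 / 4 - J^2 / 4 \<and> ?Q (?m j) \<ge> 1" if "(j, E) \<in> D" for j
  proof
    note mj = *[OF that]
    show "(?m j - ?m J) * ?Q (?m j) = j^2 / 4 - J^2 / 4"
      using mj m0 by (simp add: algebra_simps power2_eq_square)
    have "?m j * ?m J > 0" using mj m0 by simp
    then show "?Q (?m j) \<ge> 1" using mj m0 zero_le_power2[of "?m J"] by (smt (verit))
  qed
  then have ev: "\<forall>\<^sub>F j in nhds J. (?m j - ?m J) * ?Q (?m j) = j^2 / 4 - J^2 / 4 \<and> ?Q (?m j) \<ge> 1"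
    using D_open_sections(2)[OF assms] by (auto elim: eventually_mono)
  have "((\<lambda>j. j^2 / 4) has_real_derivative J / 2) (at J)" by (auto intro!: derivative_eq_intros)
  moreover have "isCont ?Q (?m J)" by (intro continuous_intros)
  ultimately have "(?m has_real_derivative (J / 2) / ?Q (?m J)) (at J)"
    by (intro implicit_has_real_derivative[where m = ?m and t = J and Q = ?Q, OF ev])
  moreover have q: "?Q (?m J) = ((2 + 3 * mid J E)^2 - (rad J E)^2) / 4"
    using D_mid_rad(4)[OF assms] by (simp add: field_simps power2_eq_square)
  ultimately show ?thesis unfolding q by simp
qed

section \<open>Differentiation of kernel integrals along a curve parametrized by
  \<open>m\<close>\<close>

text \<open>Here \<open>\<delta>\<close> is \<open>rad^2\<close> as a function of
  \<open>mid\<close>; keeping it as a parameter covers both families of curves at once, and the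
  square is a rational function of \<open>m\<close> on each of them.\<close>

definition profile :: "(real \<Rightarrow> real) \<Rightarrow> real \<Rightarrow> real \<Rightarrow> real" where
  "profile \<delta> m \<phi> = 2 + 3 * m - sqrt (\<delta> m) * cos (2 * \<phi>)"

definition kernel_integral :: "(real \<Rightarrow> real \<Rightarrow> real) \<Rightarrow> (real \<Rightarrow> real) \<Rightarrow> real \<Rightarrow> real" where
  "kernel_integral f \<delta> m = integral {0..pi/2} (\<lambda>\<phi>. f m (profile \<delta> m \<phi>))"

lemma profile_lower_bound:
  assumes "sqrt (\<delta> m) \<le> m" "0 \<le> \<delta> m"
  shows "2 + 2 * m \<le> profile \<delta> m \<phi>"
proof -
  have "sqrt (\<delta> m) * cos (2 * \<phi>) \<le> sqrt (\<delta> m) * 1" using assms by (intro mult_left_mono) auto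
  then show ?thesis using assms unfolding profile_def by linarith
qed

lemma continuous_on_profile: "continuous_on S (profile \<delta> m)"
  unfolding profile_def by (intro continuous_intros)

text \<open>The functions \<open>fm\<close>, \<open>fx\<close>, \<open>fxx\<close> are partial
  derivatives of \<open>f\<close>. Joint differentiability enters in \<open>f_chain\<close> as the
  chain rule along the curves \<open>(m, Y m)\<close>, the form in which it is applied.\<close>

locale kernel =
  fixes f fm fx fxx :: "real \<Rightarrow> real \<Rightarrow> real"
  assumes f_chain: "0 < m \<Longrightarrow> 0 < Y m \<Longrightarrow> (Y has_real_derivative Y') (at m) \<Longrightarrow>
      ((\<lambda>m. f m (Y m)) has_real_derivative fm m (Y m) + fx m (Y m) * Y') (at m)"
    and f_cont: "0 < m \<Longrightarrow> continuous_on {0<..} (f m)"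
    and fx_deriv: "0 < m \<Longrightarrow> 0 < x \<Longrightarrow> (fx m has_real_derivative fxx m x) (at x)"
    and fm_cont: "continuous_on ({0<..} \<times> {0<..}) (\<lambda>p. fm (fst p) (snd p))"
    and fx_cont: "continuous_on ({0<..} \<times> {0<..}) (\<lambda>p. fx (fst p) (snd p))"
    and fxx_cont: "continuous_on ({0<..} \<times> {0<..}) (\<lambda>p. fxx (fst p) (snd p))"
begin

text \<open>The integrand left after integration by parts; \<open>c\<close> stands for half the
  derivative of \<open>\<delta>\<close>, that is, \<open>rad\<close> times its derivative along the
  curve.\<close>

definition dK :: "(real \<Rightarrow> real) \<Rightarrow> real \<Rightarrow> real \<Rightarrow> real \<Rightarrow> real" where
  "dK \<delta> m c \<phi> = fm m (profile \<delta> m \<phi>) + 3 * fx m (profile \<delta> m \<phi>)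
                    + c * fxx m (profile \<delta> m \<phi>) * (sin (2 * \<phi>))^2"

lemma continuous_on_dK:
  assumes "0 < m" "\<And>\<phi>. 0 < profile \<delta> m \<phi>"
  shows "continuous_on S (dK \<delta> m c)" "continuous_on S (\<lambda>\<phi>. f m (profile \<delta> m \<phi>))"
    "continuous_on S (\<lambda>\<phi>. fm m (profile \<delta> m \<phi>))" "continuous_on S (\<lambda>\<phi>. fx m (profile \<delta> m \<phi>))"
    "continuous_on S (\<lambda>\<phi>. fxx m (profile \<delta> m \<phi>))"
proof -
  have c: "continuous_on S (\<lambda>\<phi>. (m, profile \<delta> m \<phi>))"
    by (intro continuous_intros continuous_on_profile)
  have i: "(\<lambda>\<phi>. (m, profile \<delta> m \<phi>)) ` S \<subseteq> {0<..} \<times> {0<..}" using assms by auto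
  show 1: "continuous_on S (\<lambda>\<phi>. fm m (profile \<delta> m \<phi>))" "continuous_on S (\<lambda>\<phi>. fx m (profile \<delta> m \<phi>))"
    "continuous_on S (\<lambda>\<phi>. fxx m (profile \<delta> m \<phi>))"
    using continuous_on_compose2[OF fm_cont c i] continuous_on_compose2[OF fx_cont c i]
      continuous_on_compose2[OF fxx_cont c i] by simp_all
  show "continuous_on S (\<lambda>\<phi>. f m (profile \<delta> m \<phi>))"
    using assms by (intro continuous_on_compose2[OF f_cont continuous_on_profile]) auto
  show "continuous_on S (dK \<delta> m c)"
    unfolding dK_def using 1 by (intro continuous_intros)
qed

text \<open>The Leibniz rule yields an integrand with a factor
  \<open>1 / sqrt (\<delta> m0)\<close>. Adding a multiple of a function whose integral vanishes
  removes this factor.\<close>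

lemma kernel_integral_has_derivative:
  assumes m0: "0 < m0" "0 < \<delta> m0" "sqrt (\<delta> m0) \<le> m0"
    and \<delta>: "\<And>m. 0 < m \<Longrightarrow> (\<delta> has_real_derivative \<delta>' m) (at m)" "continuous_on {0<..} \<delta>'"
  shows "(kernel_integral f \<delta> has_real_derivative integral {0..pi/2} (dK \<delta> m0 (\<delta>' m0 / 2))) (at m0)"
proof -
  have "isCont \<delta> m0" using \<delta>(1)[OF m0(1)] by (rule DERIV_isCont)
  then have c: "((\<lambda>m. \<delta> m) \<longlongrightarrow> \<delta> m0) (nhds m0)" "((\<lambda>m. 2 + 3 * m - sqrt (\<delta> m)) \<longlongrightarrow> 2 + 3 * m0 - sqrt (\<delta> m0)) (nhds m0)"
    "((\<lambda>m. m) \<longlongrightarrow> m0) (nhds m0)"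
    by (auto intro!: tendsto_intros filterlim_ident simp: isCont_def tendsto_at_iff_tendsto_nhds)
  \<comment> \<open>The last quantity is the minimum of the profile, so its positivity keeps the
    whole profile inside the domain of the kernel.\<close>
  have "\<forall>\<^sub>F m in nhds m0. 0 < m \<and> 0 < \<delta> m \<and> 0 < 2 + 3 * m - sqrt (\<delta> m)"
    using m0 by (intro eventually_conj order_tendstoD(1)[OF c(1)] order_tendstoD(1)[OF c(2)] order_tendstoD(1)[OF c(3)]) auto
  then obtain \<epsilon> where \<epsilon>: "\<epsilon> > 0" "\<And>m. m \<in> ball m0 \<epsilon> \<Longrightarrow> 0 < m \<and> 0 < \<delta> m \<and> 0 < 2 + 3 * m - sqrt (\<delta> m)"
    unfolding eventually_nhds_metric by (auto simp: dist_commute)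
  define U where "U = ball m0 \<epsilon>"
  have U: "m0 \<in> U" "convex U" "open U" using \<epsilon>(1) by (auto simp: U_def)
  have pos: "0 < m" "0 < \<delta> m" "0 < profile \<delta> m \<phi>" if "m \<in> U" for m \<phi>
  proof -
    show "0 < m" and d: "0 < \<delta> m" using \<epsilon>(2) that by (auto simp: U_def)
    have "sqrt (\<delta> m) * cos (2 * \<phi>) \<le> sqrt (\<delta> m) * 1" using d by (intro mult_left_mono) auto
    moreover have "0 < 2 + 3 * m - sqrt (\<delta> m)" using \<epsilon>(2) that by (simp add: U_def)
    ultimately show "0 < profile \<delta> m \<phi>" unfolding profile_def by linarith
  qed
  let ?X' = "\<lambda>m \<phi>. 3 - \<delta>' m / (2 * sqrt (\<delta> m)) * cos (2 * \<phi>)"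
  let ?g = "\<lambda>m \<phi>. fm m (profile \<delta> m \<phi>) + fx m (profile \<delta> m \<phi>) * ?X' m \<phi>"
  have der: "((\<lambda>m. f m (profile \<delta> m \<phi>)) has_real_derivative ?g m \<phi>) (at m within U)" if "m \<in> U" for m \<phi>
  proof -
    have "((\<lambda>m. profile \<delta> m \<phi>) has_real_derivative ?X' m \<phi>) (at m)"
      unfolding profile_def using pos[OF that] \<delta>(1)[OF pos(1)[OF that]]
      by (auto intro!: derivative_eq_intros simp: field_simps)
    from f_chain[where Y = "\<lambda>m. profile \<delta> m \<phi>", OF pos(1,3)[OF that] this]
    show ?thesis by (rule has_field_derivative_at_within)
  qed
  have \<delta>c: "continuous_on U \<delta>"
    using \<delta>(1) pos(1) by (meson DERIV_isCont continuous_at_imp_continuous_on)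
  have "continuous_on U \<delta>'" using \<delta>(2) by (rule continuous_on_subset) (use pos in auto)
  \<comment> \<open>In the second fact \<open>this\<close> is the continuity of
    \<open>\<delta>'\<close> on \<open>U\<close>.\<close>
  note fs = continuous_on_compose2[OF \<delta>c continuous_on_fst[OF continuous_on_id]]
    continuous_on_compose2[OF this continuous_on_fst[OF continuous_on_id]]
  let ?R = "U \<times> cbox 0 (pi/2)"
  have Xc: "continuous_on ?R (\<lambda>p. (fst p, profile \<delta> (fst p) (snd p)))"
    unfolding profile_def by (intro continuous_intros fs) auto
  have Xi: "(\<lambda>p. (fst p, profile \<delta> (fst p) (snd p))) ` ?R \<subseteq> {0<..} \<times> {0<..}" using pos by auto
  have gc: "continuous_on ?R (\<lambda>p. ?g (fst p) (snd p))"
    using continuous_on_compose2[OF fm_cont Xc Xi] continuous_on_compose2[OF fx_cont Xc Xi] pos(2)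
    by (intro continuous_intros fs) (auto dest: pos(2) simp: less_imp_neq[symmetric])
  have "((\<lambda>m. integral (cbox 0 (pi/2)) (\<lambda>\<phi>. f m (profile \<delta> m \<phi>))) has_field_derivative
        integral (cbox 0 (pi/2)) (?g m0)) (at m0 within U)"
    using der U gc pos
    by (intro leibniz_rule_field_derivative integrable_continuous continuous_on_dK(2))
      (auto simp: case_prod_beta')
  then have KD: "(kernel_integral f \<delta> has_real_derivative integral {0..pi/2} (?g m0)) (at m0)"
    unfolding kernel_integral_def by (simp add: at_within_open[OF U(1,3)] cbox_interval)
  let ?s = "sqrt (\<delta> m0)"
  \<comment> \<open>This is the derivative of
    \<open>fx m0 (profile \<delta> m0 \<phi>) * sin (2 * \<phi>)\<close>, which vanishes at both
    endpoints.\<close>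
  let ?h = "\<lambda>\<phi>. 2 * cos (2 * \<phi>) * fx m0 (profile \<delta> m0 \<phi>)
                + 2 * ?s * fxx m0 (profile \<delta> m0 \<phi>) * (sin (2 * \<phi>))^2"
  have "(?h has_integral fx m0 (profile \<delta> m0 (pi/2)) * sin (2 * (pi/2)) - fx m0 (profile \<delta> m0 0) * sin (2 * 0)) {0..pi/2}"
  proof (intro fundamental_theorem_of_calculus)
    fix \<phi> :: real
    have "(profile \<delta> m0 has_real_derivative 2 * ?s * sin (2 * \<phi>)) (at \<phi>)"
      unfolding profile_def by (auto intro!: derivative_eq_intros)
    from DERIV_chain2[OF fx_deriv[OF m0(1) pos(3)[OF U(1)]] this]
    have "((\<lambda>\<phi>. fx m0 (profile \<delta> m0 \<phi>) * sin (2 * \<phi>)) has_real_derivative ?h \<phi>) (at \<phi>)"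
      by (auto intro!: derivative_eq_intros simp: power2_eq_square)
    then show "((\<lambda>\<phi>. fx m0 (profile \<delta> m0 \<phi>) * sin (2 * \<phi>)) has_vector_derivative ?h \<phi>) (at \<phi> within {0..pi/2})"
      by (simp add: has_real_derivative_iff_has_vector_derivative[symmetric] has_field_derivative_at_within)
  qed simp
  then have h0: "(?h has_integral 0) {0..pi/2}" by simp
  have "?g m0 integrable_on {0..pi/2}"
    using U pos m0 by (intro integrable_continuous_real continuous_intros continuous_on_dK) auto
  \<comment> \<open>The multiplier is chosen to cancel the \<open>cos (2 * \<phi>)\<close> term of
    \<open>?g\<close>; the \<open>sin\<close> term then has coefficient
    \<open>\<delta>' m0 / 2\<close>.\<close>
  then have "((\<lambda>\<phi>. ?g m0 \<phi> + \<delta>' m0 / (4 * ?s) * ?h \<phi>) has_integral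
      integral {0..pi/2} (?g m0) + \<delta>' m0 / (4 * ?s) * 0) {0..pi/2}"
    by (intro has_integral_add has_integral_mult_right h0 integrable_integral)
  moreover have "(\<lambda>\<phi>. ?g m0 \<phi> + \<delta>' m0 / (4 * ?s) * ?h \<phi>) = dK \<delta> m0 (\<delta>' m0 / 2)"
    using m0(2) by (auto simp: dK_def fun_eq_iff field_simps)
  ultimately have "integral {0..pi/2} (dK \<delta> m0 (\<delta>' m0 / 2)) = integral {0..pi/2} (?g m0)"
    by (simp add: integral_unique)
  then show ?thesis using KD by simp
qed

end

section \<open>The elementary integral responsible for the term \<open>pi * sgn J\<close>\<close>

lemma integral_inverse_ellipse:
  fixes a b :: real
  assumes "a > 0" "b > 0"
  shows "((\<lambda>\<phi>. 1 / (a^2 * (cos \<phi>)^2 + b^2 * (sin \<phi>)^2)) has_integral pi / (2 * a * b)) {0..pi/2}"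
proof -
  \<comment> \<open>The primitive is \<open>arctan (b / a * tan \<phi>) / (a * b)\<close>, rewritten so as to be smooth at \<open>pi / 2\<close>.\<close>
  let ?M = "\<lambda>\<phi>. a * (cos \<phi>)^2 + b * (sin \<phi>)^2"
  let ?N = "\<lambda>\<phi>. (b - a) * (sin \<phi> * cos \<phi>)"
  let ?F = "\<lambda>\<phi>. (\<phi> + arctan (?N \<phi> / ?M \<phi>)) / (a * b)"
  have "((\<lambda>\<phi>. 1 / (a^2 * (cos \<phi>)^2 + b^2 * (sin \<phi>)^2)) has_integral ?F (pi/2) - ?F 0) {0..pi/2}"
  proof (intro fundamental_theorem_of_calculus)
    fix \<phi> :: real
    define c t where "c = cos \<phi>" "t = sin \<phi>"
    have ct: "c^2 + t^2 = 1" by (simp add: c_t_def)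
    then have "c^2 > 0 \<or> t^2 > 0" by (metis add_0 zero_less_power2 power_zero_numeral zero_neq_one)
    then have M: "a * c^2 + b * t^2 > 0" and L: "a^2 * c^2 + b^2 * t^2 > 0"
      using assms by (auto intro: add_pos_nonneg add_nonneg_pos)
    define M N where "M = a * c^2 + b * t^2" "N = (b - a) * (t * c)"
    \<comment> \<open>The two-squares identity for the vectors \<open>(a * c, b * t)\<close> and
      \<open>(c, t)\<close>, the second of which has length 1.\<close>
    have MN: "M^2 + N^2 = a^2 * c^2 + b^2 * t^2"
    proof -
      have "M^2 + N^2 = (a^2 * c^2 + b^2 * t^2) * (c^2 + t^2)"
        unfolding M_N_def by algebra
      then show ?thesis using ct by simp
    qed
    \<comment> \<open>The numerator of \<open>1 + (N / M)' / (1 + (N / M)^2)\<close>, where the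
      prime is the derivative in \<open>\<phi>\<close>.\<close>
    have num: "M^2 + N^2 + ((b - a) * (c^2 - t^2) * M - N * (2 * (b - a) * (t * c))) = a * b"
    proof -
      have "M^2 + N^2 + ((b - a) * (c^2 - t^2) * M - N * (2 * (b - a) * (t * c))) = a * b * (c^2 + t^2)^2"
        unfolding M_N_def by algebra
      then show ?thesis using ct by simp
    qed
    have N': "(?N has_real_derivative (b - a) * (c^2 - t^2)) (at \<phi>)"
      unfolding c_t_def by (auto intro!: derivative_eq_intros simp: power2_eq_square algebra_simps)
    have M': "(?M has_real_derivative 2 * (b - a) * (t * c)) (at \<phi>)"
      unfolding c_t_def by (auto intro!: derivative_eq_intros simp: power2_eq_square algebra_simps)
    have NM': "((\<lambda>\<phi>. ?N \<phi> / ?M \<phi>) has_real_derivative ((b - a) * (c^2 - t^2) * M - N * (2 * (b - a) * (t * c))) / (M * M)) (at \<phi>)"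
      using DERIV_divide[OF N' M'] M by (simp add: c_t_def M_N_def)
    have "(?F has_real_derivative (1 + inverse (1 + (N / M)^2) * (((b - a) * (c^2 - t^2) * M - N * (2 * (b - a) * (t * c))) / (M * M))) / (a * b)) (at \<phi>)"
      unfolding M_N_def c_t_def
      by (rule DERIV_cdivide[OF DERIV_add[OF DERIV_ident DERIV_chain2[OF DERIV_arctan NM'[unfolded M_N_def c_t_def]]]])
    also have "1 + inverse (1 + (N / M)^2) * (((b - a) * (c^2 - t^2) * M - N * (2 * (b - a) * (t * c))) / (M * M))
        = (M^2 + N^2 + ((b - a) * (c^2 - t^2) * M - N * (2 * (b - a) * (t * c)))) / (M^2 + N^2)"
    proof -
      have "inverse (1 + (N / M)^2) = M^2 / (M^2 + N^2)"
        using M by (simp add: M_N_def[symmetric] field_simps)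
      moreover have "M \<noteq> 0" "M^2 + N^2 \<noteq> 0" using M L MN by (auto simp: M_N_def(1))
      ultimately show ?thesis by (simp add: power2_eq_square add_divide_distrib)
    qed
    also have "\<dots> / (a * b) = 1 / (a^2 * c^2 + b^2 * t^2)" unfolding num unfolding MN using assms by simp
    finally show "(?F has_vector_derivative 1 / (a^2 * (cos \<phi>)^2 + b^2 * (sin \<phi>)^2)) (at \<phi> within {0..pi/2})"
      by (simp add: has_real_derivative_iff_has_vector_derivative[symmetric] has_field_derivative_at_within c_t_def)
  qed simp
  then show ?thesis by (simp add: mult.assoc)
qed

section \<open>The kernels of the period and of the renormalized phase\<close>

definition period_kernel :: "real \<Rightarrow> real \<Rightarrow> real" where "period_kernel m x = 1 / sqrt x"
definition period_kernel_x :: "real \<Rightarrow> real \<Rightarrow> real" where "period_kernel_x m x = - 1 / (2 * x * sqrt x)"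
definition period_kernel_xx :: "real \<Rightarrow> real \<Rightarrow> real" where "period_kernel_xx m x = 3 / (4 * x^2 * sqrt x)"

text \<open>
  Subtracting \<open>1 / (s sqrt (- y3))\<close>, whose integral yields exactly \<open>pi * sgn J\<close>, from the integrand of
  \<open>Phi / J\<close> leaves minus this kernel, with \<open>2 + 2 m = - y3\<close> and \<open>x = s - y3\<close>.
\<close>

definition phase_kernel :: "real \<Rightarrow> real \<Rightarrow> real" where
  "phase_kernel m x = 1 / ((2 + 2 * m) * sqrt x + x * sqrt (2 + 2 * m))"
definition phase_kernel_m :: "real \<Rightarrow> real \<Rightarrow> real" where
  "phase_kernel_m m x = - (2 * sqrt x + x / sqrt (2 + 2 * m)) * (phase_kernel m x)^2"
definition phase_kernel_x :: "real \<Rightarrow> real \<Rightarrow> real" where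
  "phase_kernel_x m x = - ((2 + 2 * m) / (2 * sqrt x) + sqrt (2 + 2 * m)) * (phase_kernel m x)^2"
definition phase_kernel_xx :: "real \<Rightarrow> real \<Rightarrow> real" where
  "phase_kernel_xx m x = 2 * ((2 + 2 * m) / (2 * sqrt x) + sqrt (2 + 2 * m))^2 * (phase_kernel m x)^3
               + (2 + 2 * m) / (4 * x * sqrt x) * (phase_kernel m x)^2"

interpretation period: kernel period_kernel "\<lambda>_ _. 0" period_kernel_x period_kernel_xx
proof
  fix m x Y' :: real and Y :: "real \<Rightarrow> real"
  show "((\<lambda>m. period_kernel m (Y m)) has_real_derivative 0 + period_kernel_x m (Y m) * Y') (at m)"
    if "0 < Y m" "(Y has_real_derivative Y') (at m)"
    unfolding period_kernel_def period_kernel_x_def using that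
    by (auto intro!: derivative_eq_intros simp: field_simps)
  show "continuous_on {0<..} (period_kernel m)"
    unfolding period_kernel_def by (intro continuous_intros) auto
  show "(period_kernel_x m has_real_derivative period_kernel_xx m x) (at x)" if "0 < x"
    unfolding period_kernel_x_def period_kernel_xx_def using that
    by (auto intro!: derivative_eq_intros simp: field_simps power2_eq_square)
  show "continuous_on ({0<..} \<times> {0<..}) (\<lambda>p. period_kernel_x (fst p) (snd p))"
    "continuous_on ({0<..} \<times> {0<..}) (\<lambda>p. period_kernel_xx (fst p) (snd p))"
    unfolding period_kernel_x_def period_kernel_xx_def by (intro continuous_intros; auto)+
qed auto

text \<open>Keeps the square of the reciprocal visible, which is the shape of
  \<open>phase_kernel_m\<close> and \<open>phase_kernel_x\<close>.\<close>

lemma DERIV_one_divide: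
  fixes g :: "real \<Rightarrow> real"
  assumes "(g has_real_derivative g') (at t)" "g t \<noteq> 0"
  shows "((\<lambda>t. 1 / g t) has_real_derivative - g' * (1 / g t)^2) (at t)"
  using assms by (auto intro!: derivative_eq_intros simp: power2_eq_square)

lemma phase_kernel_denom_pos: "0 < m \<Longrightarrow> 0 < x \<Longrightarrow> 0 < (2 + 2 * m) * sqrt x + x * sqrt (2 + 2 * m)"
  by (intro add_pos_pos mult_pos_pos) auto

lemma continuous_on_phase_kernel:
  assumes "S \<subseteq> {0<..} \<times> {0<..}"
  shows "continuous_on S (\<lambda>p. phase_kernel (fst p) (snd p))"
  unfolding phase_kernel_def using assms phase_kernel_denom_pos
  by (intro continuous_intros) (force dest: less_imp_neq)

interpretation phase: kernel phase_kernel phase_kernel_m phase_kernel_x phase_kernel_xx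
proof
  fix m x Y' :: real and Y :: "real \<Rightarrow> real"
  assume m: "0 < m"
  let ?s = "sqrt (2 + 2 * m)"
  show "((\<lambda>m. phase_kernel m (Y m)) has_real_derivative phase_kernel_m m (Y m) + phase_kernel_x m (Y m) * Y') (at m)"
    if Y: "0 < Y m" "(Y has_real_derivative Y') (at m)"
  proof -
    have "((\<lambda>m. (2 + 2 * m) * sqrt (Y m) + Y m * sqrt (2 + 2 * m)) has_real_derivative
        (2 * sqrt (Y m) + Y m / ?s) + ((2 + 2 * m) / (2 * sqrt (Y m)) + ?s) * Y') (at m)"
      using m Y by (auto intro!: derivative_eq_intros simp: field_simps)
    from DERIV_one_divide[OF this less_imp_neq[OF phase_kernel_denom_pos[OF m Y(1)], symmetric]] show ?thesis
      unfolding phase_kernel_def phase_kernel_m_def phase_kernel_x_def by (rule DERIV_cong) (simp add: algebra_simps)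
  qed
  show "continuous_on {0<..} (phase_kernel m)"
    unfolding phase_kernel_def using phase_kernel_denom_pos[OF m]
    by (intro continuous_intros) (force dest: less_imp_neq)
  show "(phase_kernel_x m has_real_derivative phase_kernel_xx m x) (at x)" if x: "0 < x"
  proof -
    have *: "((\<lambda>x. (2 + 2 * m) * sqrt x + x * ?s) has_real_derivative (2 + 2 * m) / (2 * sqrt x) + ?s) (at x)"
      using x by (auto intro!: derivative_eq_intros simp: field_simps)
    have p: "(phase_kernel m has_real_derivative phase_kernel_x m x) (at x)"
      unfolding phase_kernel_def phase_kernel_x_def
      using DERIV_one_divide[OF * less_imp_neq[OF phase_kernel_denom_pos[OF m x], symmetric]] .
    have ss: "sqrt x * (sqrt x * y) = x * y" for y using x by (simp add: mult.assoc[symmetric])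
    \<comment> \<open>\<open>U\<close> is the first derivative in \<open>x\<close> of the
      denominator of the kernel, and \<open>- V\<close> the second.\<close>
    define U V where "U = (2 + 2 * m) / (2 * sqrt x) + ?s" "V = (2 + 2 * m) / (4 * x * sqrt x)"
    have q: "((\<lambda>x. (2 + 2 * m) / (2 * sqrt x) + ?s) has_real_derivative - V) (at x)"
      unfolding U_V_def using x by (auto intro!: derivative_eq_intros simp: field_simps ss)
    have "- U * (real 2 * (phase_kernel m x ^ (2 - Suc 0) * phase_kernel_x m x)) + - (- V) * (phase_kernel m x)^2 = phase_kernel_xx m x"
      unfolding phase_kernel_x_def phase_kernel_xx_def U_V_def[symmetric]
      by (simp add: algebra_simps power2_eq_square power3_eq_cube)
    with DERIV_mult[OF DERIV_minus[OF q] DERIV_power[OF p, of 2]]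
    have "((\<lambda>x. - ((2 + 2 * m) / (2 * sqrt x) + ?s) * (phase_kernel m x)^2) has_real_derivative phase_kernel_xx m x) (at x)"
      by (auto elim!: DERIV_cong simp: U_V_def ac_simps)
    then show ?thesis unfolding phase_kernel_x_def[abs_def] .
  qed
next
  show "continuous_on ({0<..} \<times> {0<..}) (\<lambda>p. phase_kernel_m (fst p) (snd p))"
    "continuous_on ({0<..} \<times> {0<..}) (\<lambda>p. phase_kernel_x (fst p) (snd p))"
    "continuous_on ({0<..} \<times> {0<..}) (\<lambda>p. phase_kernel_xx (fst p) (snd p))"
    unfolding phase_kernel_m_def phase_kernel_x_def phase_kernel_xx_def by (intro continuous_intros continuous_on_phase_kernel; auto)+
qed

section \<open>Pointwise estimates for the kernels and for the integrands \<open>dK\<close>\<close>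

text \<open>With \<open>p = sqrt (2 + 2 * m)\<close> and \<open>r = sqrt x\<close> the kernel is
  \<open>1 / (p * r * (p + r))\<close>, and its derivatives are the kernel times rational functions
  of \<open>p\<close> and \<open>r\<close>. From \<open>p \<le> r\<close> the ratio
  \<open>(2 * p + r) / (p + r)\<close> is at most 3/2, and \<open>(p / 2 + r) / (p + r)\<close> lies
  between 3/4 and 1.\<close>

lemma phase_kernel_bounds:
  assumes "0 < m" "2 + 2 * m \<le> x"
  shows "0 < phase_kernel m x" "- 3 / (4 * (1 + m)) * phase_kernel m x \<le> phase_kernel_m m x" "phase_kernel_m m x \<le> 0"
    "- 1 / x * phase_kernel m x \<le> phase_kernel_x m x" "phase_kernel_x m x \<le> - 3 / (4 * x) * phase_kernel m x"
    "0 \<le> phase_kernel_xx m x" "phase_kernel_xx m x \<le> 2 / x^2 * phase_kernel m x"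
proof -
  define p r where "p = sqrt (2 + 2 * m)" "r = sqrt x"
  have pr: "0 < p" "p \<le> r" "0 < r" and b: "2 + 2 * m = p^2" and x: "x = r^2"
    using assms by (auto simp: p_r_def)
  have sq: "sqrt (2 + 2 * m) = p" "sqrt x = r" by (simp_all add: p_r_def)
  have F: "phase_kernel m x = 1 / (p * r * (p + r))"
    unfolding phase_kernel_def sq unfolding b x by (simp add: power2_eq_square algebra_simps)
  then show pos: "0 < phase_kernel m x" using pr by simp
  have Fm: "phase_kernel_m m x = - ((2 * p + r) / (p^2 * (p + r))) * phase_kernel m x"
    unfolding phase_kernel_m_def F sq unfolding b x using pr by (simp add: divide_simps) algebra
  have Fx: "phase_kernel_x m x = - ((p / 2 + r) / (r^2 * (p + r))) * phase_kernel m x"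
    unfolding phase_kernel_x_def F sq unfolding b x using pr by (simp add: divide_simps) algebra
  have Fxx: "phase_kernel_xx m x = (2 * ((p / 2 + r) / (r^2 * (p + r)))^2 + p / (4 * r^4 * (p + r))) * phase_kernel m x"
    unfolding phase_kernel_xx_def F sq unfolding b x using pr by (simp add: divide_simps) algebra
  have "(2 * p + r) / (p^2 * (p + r)) \<le> 3 / (2 * p^2)"
    using pr by (simp add: divide_simps)
  moreover have "3 / (4 * (1 + m)) = 3 / (2 * p^2)"
    unfolding b[symmetric] using assms by (simp add: divide_simps)
  ultimately show "- 3 / (4 * (1 + m)) * phase_kernel m x \<le> phase_kernel_m m x"
    unfolding Fm using pos by (intro mult_right_mono) auto
  show "phase_kernel_m m x \<le> 0" unfolding Fm using pos pr by (intro mult_nonpos_nonneg) auto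
  show "- 1 / x * phase_kernel m x \<le> phase_kernel_x m x"
    unfolding Fx unfolding x using pr by (intro mult_right_mono less_imp_le[OF pos[unfolded x]]) (simp add: divide_simps)
  show "phase_kernel_x m x \<le> - 3 / (4 * x) * phase_kernel m x"
    unfolding Fx unfolding x using pr by (intro mult_right_mono less_imp_le[OF pos[unfolded x]]) (simp add: divide_simps)
  show "0 \<le> phase_kernel_xx m x" unfolding Fxx using pos pr by simp
  have "8 * (p / 2 + r)^2 + p * (p + r) \<le> 8 * (p + r)^2"
    using pr by (simp add: power2_eq_square algebra_simps)
  then have "(8 * (p / 2 + r)^2 + p * (p + r)) / (4 * r^4 * (p + r)^2) \<le> 8 * (p + r)^2 / (4 * r^4 * (p + r)^2)"
    by (intro divide_right_mono) auto
  moreover have "(8 * (p / 2 + r)^2 + p * (p + r)) / (4 * r^4 * (p + r)^2)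
      = 2 * ((p / 2 + r) / (r^2 * (p + r)))^2 + p / (4 * r^4 * (p + r))"
    using pr by (simp add: divide_simps) algebra
  moreover have "8 * (p + r)^2 / (4 * r^4 * (p + r)^2) = 2 / x^2" using pr by (simp add: x)
  ultimately show "phase_kernel_xx m x \<le> 2 / x^2 * phase_kernel m x"
    unfolding Fxx using pos by (intro mult_right_mono) auto
qed

context
  fixes m x c w :: real
  assumes mx: "0 < m" "2 + 2 * m \<le> x" and w: "0 \<le> w" "w \<le> 1"
begin

text \<open>In this context \<open>w\<close> stands for \<open>(sin (2 * \<phi>))^2\<close>. The
  expression is a positive multiple of \<open>c * w - 2 * x\<close>, and \<open>x\<close> exceeds
  \<open>2 * m\<close>.\<close>

lemma period_kernel_dK_neg:
  assumes c: "c \<le> 3 / 2 * m"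
  shows "3 * period_kernel_x m x + c * period_kernel_xx m x * w < 0"
proof -
  have "c * w \<le> (3 / 2 * m) * w" using c w by (intro mult_right_mono) auto
  also have "\<dots> \<le> (3 / 2 * m) * 1" using mx w by (intro mult_left_mono) auto
  also have "\<dots> < 2 * x" using mx by simp
  finally have "3 / (4 * x^2 * sqrt x) * (c * w - 2 * x) < 0"
    using mx by (intro mult_pos_neg) auto
  also have "3 / (4 * x^2 * sqrt x) * (c * w - 2 * x) = 3 * period_kernel_x m x + c * period_kernel_xx m x * w"
    unfolding period_kernel_x_def period_kernel_xx_def using mx by (simp add: field_simps power2_eq_square)
  finally show ?thesis .
qed

text \<open>Only the \<open>phase_kernel_xx\<close> term can be positive. Since
  \<open>x \<ge> 2 * m\<close>, it is at most 3/2 of \<open>phase_kernel m x / x\<close>, whereas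
  the \<open>phase_kernel_x\<close> term is at most -9/4 of it.\<close>

lemma phase_kernel_dK_neg:
  assumes c: "c \<le> 3 / 2 * m"
  shows "phase_kernel_m m x + 3 * phase_kernel_x m x + c * phase_kernel_xx m x * w < 0"
proof -
  note b = phase_kernel_bounds[OF mx]
  have "c * (phase_kernel_xx m x * w) \<le> (3 / 2 * m) * (phase_kernel_xx m x * w)" using c w b by (intro mult_right_mono) auto
  also have "phase_kernel_xx m x * w \<le> phase_kernel_xx m x * 1" using w b by (intro mult_left_mono) auto
  also have "phase_kernel_xx m x * 1 \<le> 2 / x^2 * phase_kernel m x" using b by simp
  also have "(3 / 2 * m) * (2 / x^2 * phase_kernel m x) = 3 * m / x * (1 / x * phase_kernel m x)"
    using mx by (simp add: power2_eq_square)
  also have "\<dots> \<le> 3 / 2 * (1 / x * phase_kernel m x)"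
    using mx b(1) by (intro mult_right_mono) (auto simp: divide_simps)
  finally have "c * phase_kernel_xx m x * w \<le> 3 / 2 * (1 / x * phase_kernel m x)" using mx by (simp add: mult.assoc)
  moreover have "3 * phase_kernel_x m x \<le> - 9 / 4 * (1 / x * phase_kernel m x)" using b(5) by simp
  moreover have "1 / x * phase_kernel m x > 0" using b(1) mx by simp
  ultimately show ?thesis using b(3) by linarith
qed

text \<open>The coefficient \<open>- (2 + 3 * m)\<close> belongs to the curve of fixed
  \<open>E\<close>. There \<open>Psi\<close> is \<open>J\<close> times an integral, so its
  derivative in \<open>J\<close> also contains the integral itself, and the size of the other term
  has to be controlled.\<close>

lemma phase_kernel_dK_lower:
  shows "- (15 / (4 * (1 + m))) * phase_kernel m x \<le> phase_kernel_m m x + 3 * phase_kernel_x m x + (- (2 + 3 * m)) * phase_kernel_xx m x * w"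
proof -
  note b = phase_kernel_bounds[OF mx]
  let ?q = "1 / (1 + m) * phase_kernel m x"
  define q u where "q = ?q" "u = 1 / x * phase_kernel m x"
  have x1: "1 / x * phase_kernel m x \<le> 1 / 2 * ?q"
    using mult_right_mono[OF _ less_imp_le[OF b(1)], of "1 / x" "1 / 2 * (1 / (1 + m))"] mx
    by (simp add: divide_simps)
  have "(2 + 3 * m) * (phase_kernel_xx m x * w) \<le> (2 + 3 * m) * (phase_kernel_xx m x * 1)"
    using w b mx by (intro mult_left_mono) auto
  also have "phase_kernel_xx m x * 1 \<le> 2 / x^2 * phase_kernel m x" using b by simp
  also have "(2 + 3 * m) * (2 / x^2 * phase_kernel m x) = 2 * (2 + 3 * m) / x * (1 / x * phase_kernel m x)"
    using mx by (simp add: power2_eq_square)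
  also have "\<dots> \<le> 3 * (1 / x * phase_kernel m x)"
    using mx b(1) by (intro mult_right_mono) (auto simp: divide_simps)
  finally have "(2 + 3 * m) * phase_kernel_xx m x * w \<le> 3 * (1 / x * phase_kernel m x)" using mx by (simp add: mult.assoc)
  moreover have "3 * phase_kernel_x m x \<ge> - 3 * (1 / x * phase_kernel m x)" using b(4) by simp
  moreover have "phase_kernel_m m x \<ge> - (3 / 4) * ?q"
  proof -
    have "- 3 / (4 * (1 + m)) * phase_kernel m x = - (3 / 4) * ?q" by (simp add: field_simps)
    then show ?thesis using b(2) by simp
  qed
  moreover have "- (15 / (4 * (1 + m))) * phase_kernel m x = - (15 / 4) * ?q" by (simp add: field_simps)
  moreover have "(- (2 + 3 * m)) * phase_kernel_xx m x * w = - ((2 + 3 * m) * phase_kernel_xx m x * w)" by (simp only: mult_minus_left)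
  \<comment> \<open>With \<open>u \<le> q / 2\<close> the three terms cost at most 3/4, 3/2 and 3/2
    times \<open>q\<close>, in total 15/4.\<close>
  ultimately show ?thesis using x1 unfolding q_u_def[symmetric] by linarith
qed

end

section \<open>\<open>T\<close> and \<open>Psi\<close> as kernel integrals\<close>

text \<open>\<open>rad\<^sup>2\<close> as a function of \<open>mid\<close>, first for fixed \<open>J\<close>, then for fixed \<open>E\<close>.\<close>

definition radsq_J :: "real \<Rightarrow> real \<Rightarrow> real" where "radsq_J J m = m^2 - J^2 / (1 + m)"
definition radsq_E :: "real \<Rightarrow> real \<Rightarrow> real" where "radsq_E E m = 4 * E - 4 * m - 3 * m^2"

lemma rad_eq:
  assumes "(J, E) \<in> D"
  shows "radsq_J J (mid J E) = (rad J E)^2" "radsq_E E (mid J E) = (rad J E)^2"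
  using D_mid_rad[OF assms] by (auto simp: radsq_J_def radsq_E_def)

text \<open>The value of \<open>\<delta>\<close> is prescribed only at \<open>mid J E\<close>, so
  the representation applies to \<open>radsq_J J\<close> and to \<open>radsq_E E\<close>
  alike.\<close>

lemma s_minus_y3:
  assumes "(J, E) \<in> D" "\<delta> (mid J E) = (rad J E)^2"
  shows "s J E \<phi> - y3 J E = profile \<delta> (mid J E) \<phi>" "2 + 2 * mid J E \<le> profile \<delta> (mid J E) \<phi>"
proof -
  have sq: "sqrt (\<delta> (mid J E)) = rad J E" using D_mid_rad(1)[OF assms(1)] assms(2) by simp
  have y: "y1 J E = mid J E - rad J E" "y2 J E = mid J E + rad J E"
    by (simp_all add: mid_def rad_def field_simps)
  have "s J E \<phi> = mid J E * ((sin \<phi>)^2 + (cos \<phi>)^2) - rad J E * ((cos \<phi>)^2 - (sin \<phi>)^2)"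
    unfolding s_def y by algebra
  then show "s J E \<phi> - y3 J E = profile \<delta> (mid J E) \<phi>"
    unfolding profile_def sq D_mid_rad(3)[OF assms(1)] cos_double by simp
  show "2 + 2 * mid J E \<le> profile \<delta> (mid J E) \<phi>"
    using D_mid_rad(1,2)[OF assms(1)] by (intro profile_lower_bound) (auto simp: sq assms(2))
qed

lemma T_eq_kernel_integral:
  assumes "(J, E) \<in> D" "\<delta> (mid J E) = (rad J E)^2"
  shows "T J E = 2 * sqrt 2 * kernel_integral period_kernel \<delta> (mid J E)"
  unfolding T_def kernel_integral_def period_kernel_def s_minus_y3(1)[of J E \<delta>, OF assms] ..

text \<open>For \<open>J \<noteq> 0\<close> put \<open>u = sqrt (- y3)\<close> and
  \<open>v = sqrt (s - y3)\<close>. Then \<open>s = v^2 - u^2\<close>, hence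
  \<open>1 / (s * v) = 1 / (s * u) - 1 / (u * v * (u + v))\<close>; the first term integrates to the
  subtracted multiple of \<open>pi\<close>, the second is the kernel.\<close>

lemma Psi_eq_kernel_integral:
  assumes D: "(J, E) \<in> D" and \<delta>: "\<delta> (mid J E) = (rad J E)^2"
  shows "Psi J E = - (2 * sqrt 2) * J * kernel_integral phase_kernel \<delta> (mid J E)"
proof (cases "J = 0")
  case True
  then show ?thesis by (simp add: Psi_def)
next
  case False
  note h = D_mid_rad[OF D] and r = roots_D[OF D] and sX = s_minus_y3[of J E \<delta>, OF D \<delta>]
  let ?m = "mid J E" and ?b = "2 + 2 * mid J E"
  have m: "0 < ?m" using h by linarith
  \<comment> \<open>The product of the roots: it forces \<open>y1 J E > 0\<close>, so that
    \<open>1 / s\<close> has no singularity, and later evaluates the constant in front of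
    \<open>pi\<close>.\<close>
  have y12: "y1 J E * y2 J E * ?b = 2 * J^2"
    using h(5) by (simp add: mid_def rad_def field_simps power2_eq_square)
  have y1: "0 < y1 J E" and y2: "0 < y2 J E" using y12 r False by (auto simp: less_le)
  have Xp: "0 < profile \<delta> ?m \<phi>" for \<phi> using sX(2)[of \<phi>] m by linarith
  define p q where "p = sqrt (y1 J E)" "q = sqrt (y2 J E)"
  have pq: "0 < p" "0 < q" and y: "y1 J E = p^2" "y2 J E = q^2" using y1 y2 by (auto simp: p_q_def)
  have "sqrt (2 * J^2) = p * q * sqrt ?b"
    unfolding y12[symmetric] by (simp add: p_q_def real_sqrt_mult)
  then have pqb: "p * q * sqrt ?b = sqrt 2 * \<bar>J\<bar>" by (simp add: real_sqrt_mult)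
  have int1: "((\<lambda>\<phi>. 1 / s J E \<phi>) has_integral pi / (2 * p * q)) {0..pi/2}"
    unfolding s_def y by (rule integral_inverse_ellipse[OF pq])
  have "(\<lambda>\<phi>. phase_kernel ?m (profile \<delta> ?m \<phi>)) integrable_on {0..pi/2}"
    by (intro integrable_continuous_real phase.continuous_on_dK(2) m Xp)
  then have int2: "((\<lambda>\<phi>. phase_kernel ?m (profile \<delta> ?m \<phi>)) has_integral kernel_integral phase_kernel \<delta> ?m) {0..pi/2}"
    unfolding kernel_integral_def by (rule integrable_integral)
  have split: "J / s J E \<phi> * (1 / sqrt (s J E \<phi> - y3 J E))
      = J / sqrt ?b * (1 / s J E \<phi>) - J * phase_kernel ?m (profile \<delta> ?m \<phi>)" for \<phi>
  proof -
    have s: "s J E \<phi> > 0"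
    proof -
      have "y1 J E * ((cos \<phi>)^2 + (sin \<phi>)^2) \<le> s J E \<phi>"
        unfolding s_def distrib_left using r by (intro add_left_mono mult_right_mono) auto
      then show ?thesis using y1 by simp
    qed
    define u v where "u = sqrt ?b" "v = sqrt (profile \<delta> ?m \<phi>)"
    have "0 < ?b" "0 < profile \<delta> ?m \<phi>" using m sX(2)[of \<phi>] by auto
    then have uv: "0 < u" "0 < v" "?b = u^2" "profile \<delta> ?m \<phi> = v^2"
      by (auto simp: u_v_def)
    have "s J E \<phi> = v^2 - u^2" using sX(1)[of \<phi>] h(3) uv by simp
    moreover have "sqrt (s J E \<phi> - y3 J E) = v" by (simp add: sX(1) u_v_def)
    moreover have "phase_kernel ?m (profile \<delta> ?m \<phi>) = 1 / (u * v * (u + v))"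
      unfolding phase_kernel_def u_v_def[symmetric] unfolding uv by (simp add: power2_eq_square algebra_simps)
    moreover have "v^2 - u^2 \<noteq> 0" "u + v \<noteq> 0" using s uv \<open>s J E \<phi> = v^2 - u^2\<close> by auto
    ultimately show ?thesis unfolding u_v_def[symmetric] using uv(1,2)
      by (simp add: divide_simps) algebra
  qed
  have "((\<lambda>\<phi>. J / s J E \<phi> * (1 / sqrt (s J E \<phi> - y3 J E))) has_integral
      J / sqrt ?b * (pi / (2 * p * q)) - J * kernel_integral phase_kernel \<delta> ?m) {0..pi/2}"
    unfolding split by (intro has_integral_diff has_integral_mult_right int1 int2)
  then have "Phi J E = 2 * sqrt 2 * (J / sqrt ?b * (pi / (2 * p * q)) - J * kernel_integral phase_kernel \<delta> ?m)"
    unfolding Phi_def by (simp add: integral_unique)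
  moreover have "2 * sqrt 2 * (J / sqrt ?b * (pi / (2 * p * q))) = pi * sgn J"
  proof -
    have "2 * sqrt 2 * (J / sqrt ?b * (pi / (2 * p * q))) = sqrt 2 * J * pi / (p * q * sqrt ?b)"
      by (simp add: mult_ac)
    also have "\<dots> = pi * sgn J" unfolding pqb using False by (simp add: sgn_if)
    finally show ?thesis .
  qed
  ultimately show ?thesis using False by (simp add: Psi_def algebra_simps)
qed

section \<open>Signs and bounds of the integrals\<close>

lemma
  assumes D: "(J, E) \<in> D" and \<delta>: "\<delta> (mid J E) = (rad J E)^2" and c: "c \<le> 3 / 2 * mid J E"
  shows integral_period_dK_neg: "integral {0..pi/2} (period.dK \<delta> (mid J E) c) < 0"
    and integral_phase_dK_neg: "integral {0..pi/2} (phase.dK \<delta> (mid J E) c) < 0"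
proof -
  let ?m = "mid J E"
  have m: "0 < ?m" using D_mid_rad(1,2)[OF D] by linarith
  note Xb = s_minus_y3(2)[of J E \<delta>, OF D \<delta>]
  have Xp: "0 < profile \<delta> ?m \<phi>" for \<phi> using Xb[of \<phi>] m by linarith
  have w: "0 \<le> (sin (2 * \<phi>))^2" "(sin (2 * \<phi>))^2 \<le> 1" for \<phi> :: real
    by (simp_all add: abs_square_le_1)
  have "integral {0..pi/2} (period.dK \<delta> ?m c) < integral {0..pi/2} (\<lambda>_. 0)"
    using period_kernel_dK_neg[OF m Xb w c]
    by (intro integral_less_real period.continuous_on_dK(1)[OF m Xp] continuous_on_const)
      (auto simp: period.dK_def dest: leD)
  then show "integral {0..pi/2} (period.dK \<delta> ?m c) < 0" by simp
  have "integral {0..pi/2} (phase.dK \<delta> ?m c) < integral {0..pi/2} (\<lambda>_. 0)"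
    using phase_kernel_dK_neg[OF m Xb w c]
    by (intro integral_less_real phase.continuous_on_dK(1)[OF m Xp] continuous_on_const)
      (auto simp: phase.dK_def dest: leD)
  then show "integral {0..pi/2} (phase.dK \<delta> ?m c) < 0" by simp
qed

lemma
  assumes D: "(J, E) \<in> D" and \<delta>: "\<delta> (mid J E) = (rad J E)^2"
  shows phase_integral_pos: "0 < kernel_integral phase_kernel \<delta> (mid J E)"
    and integral_phase_dK_lower: "- (15 / (4 * (1 + mid J E))) * kernel_integral phase_kernel \<delta> (mid J E)
      \<le> integral {0..pi/2} (phase.dK \<delta> (mid J E) (- (2 + 3 * mid J E)))"
proof -
  let ?m = "mid J E"
  have m: "0 < ?m" using D_mid_rad(1,2)[OF D] by linarith
  note Xb = s_minus_y3(2)[of J E \<delta>, OF D \<delta>]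
  have Xp: "0 < profile \<delta> ?m \<phi>" for \<phi> using Xb[of \<phi>] m by linarith
  have w: "0 \<le> (sin (2 * \<phi>))^2" "(sin (2 * \<phi>))^2 \<le> 1" for \<phi> :: real
    by (simp_all add: abs_square_le_1)
  note cont = phase.continuous_on_dK[OF m Xp]
  have "integral {0..pi/2} (\<lambda>_. 0) < kernel_integral phase_kernel \<delta> ?m"
    unfolding kernel_integral_def using phase_kernel_bounds(1)[OF m Xb]
    by (intro integral_less_real cont continuous_on_const) (auto dest: leD)
  then show "0 < kernel_integral phase_kernel \<delta> ?m" by simp
  have "integral {0..pi/2} (\<lambda>\<phi>. - (15 / (4 * (1 + ?m))) * phase_kernel ?m (profile \<delta> ?m \<phi>))
      \<le> integral {0..pi/2} (phase.dK \<delta> ?m (- (2 + 3 * ?m)))"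
    unfolding phase.dK_def using phase_kernel_dK_lower[OF m Xb w]
    by (intro integral_le integrable_continuous_real continuous_intros cont) auto
  then show "- (15 / (4 * (1 + ?m))) * kernel_integral phase_kernel \<delta> ?m \<le> integral {0..pi/2} (phase.dK \<delta> ?m (- (2 + 3 * ?m)))"
    by (simp add: kernel_integral_def)
qed

section \<open>The four partial derivatives and the sign of the determinant\<close>

theorem proposition4p2:
  fixes J E :: real
  assumes "(J, E) \<in> D"
  shows "(\<lambda>e. T J e) differentiable at E \<and> (\<lambda>e. Psi J e) differentiable at E \<and>
         (\<lambda>j. T j E) differentiable at J \<and> (\<lambda>j. Psi j E) differentiable at J \<and>
         Delta J E > 0"
proof -
  let ?m = "mid J E" and ?d = "rad J E"
  note h = D_mid_rad[OF assms] and r = rad_eq[OF assms]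
  have m: "0 < ?m" using h by linarith
  \<comment> \<open>Half the derivatives at \<open>?m\<close> of \<open>radsq_J J\<close> and
    \<open>radsq_E E\<close>.\<close>
  let ?c = "?m + J^2 / (2 * (1 + ?m)^2)" and ?c' = "- (2 + 3 * ?m)"
  have c: "?c \<le> 3 / 2 * ?m"
  proof -
    have "J^2 / (2 * (1 + ?m)^2) = (?m^2 - ?d^2) / (2 * (1 + ?m))"
      unfolding h(5) using m by (simp add: power2_eq_square)
    also have "\<dots> \<le> ?m^2 / (2 * (1 + ?m))" using m by (intro divide_right_mono) auto
    also have "\<dots> \<le> ?m / 2" using m by (simp add: divide_simps power2_eq_square)
    finally show ?thesis by simp
  qed
  have c': "?c' \<le> 3 / 2 * ?m" using m by simp
  have dJ: "(radsq_J J has_real_derivative 2 * m + J^2 / (1 + m)^2) (at m)" if "0 < m" for m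
    unfolding radsq_J_def using that by (auto intro!: derivative_eq_intros simp: power2_eq_square)
  have dE: "(radsq_E E has_real_derivative - 4 - 6 * m) (at m)" for m
    unfolding radsq_E_def by (auto intro!: derivative_eq_intros)
  have sq: "sqrt (radsq_J J ?m) \<le> ?m" "sqrt (radsq_E E ?m) \<le> ?m" "0 < radsq_J J ?m" "0 < radsq_E E ?m"
    using h(1,2) by (simp_all add: r)
  have dJc: "continuous_on {0<..} (\<lambda>m. 2 * m + J^2 / (1 + m)^2)"
    by (intro continuous_intros) auto
  have dEc: "continuous_on {0<..} (\<lambda>m::real. - 4 - 6 * m)"
    by (intro continuous_intros)
  have half: "(2 * ?m + J^2 / (1 + ?m)^2) / 2 = ?c" "(- 4 - 6 * ?m) / 2 = ?c'"
    by (simp_all add: field_simps)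
  obtain mE where mE: "mE > 0" "((\<lambda>e. mid J e) has_real_derivative mE) (at E)"
    using mid_deriv_E[OF assms] by blast
  \<comment> \<open>The factor \<open>J\<close> is split off from the derivative of
    \<open>mid\<close> in \<open>J\<close>, which leaves a positive quantity, also at
    \<open>J = 0\<close>.\<close>
  define mJ where "mJ = 2 / ((2 + 3 * ?m)^2 - ?d^2)"
  have dm: "?d^2 \<le> ?m^2" using h by (intro power_mono) auto
  have e: "(2 + 3 * ?m)^2 = 4 + 12 * ?m + 9 * ?m^2" by (simp add: power2_eq_square algebra_simps)
  have den: "(2 + 3 * ?m)^2 - ?d^2 > 0" "15 * (?m^2 - ?d^2) < 2 * ((2 + 3 * ?m)^2 - ?d^2)"
    unfolding e right_diff_distrib distrib_left
    using dm m zero_le_power2[of ?m] zero_le_power2[of ?d] by linarith+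
  have mJ: "mJ > 0" "((\<lambda>j. mid j E) has_real_derivative J * mJ) (at J)"
    using mid_deriv_J[OF assms] den by (simp_all add: mJ_def mult.commute)
  define A B A' B' G where "A = integral {0..pi/2} (period.dK (radsq_J J) ?m ?c)"
    "B = integral {0..pi/2} (phase.dK (radsq_J J) ?m ?c)"
    "A' = integral {0..pi/2} (period.dK (radsq_E E) ?m ?c')"
    "B' = integral {0..pi/2} (phase.dK (radsq_E E) ?m ?c')"
    "G = kernel_integral phase_kernel (radsq_E E) ?m"
  have AB: "A < 0" "B < 0" "A' < 0" and G: "0 < G" "- (15 / (4 * (1 + ?m))) * G \<le> B'"
    unfolding A_B_A'_B'_G_def
    using integral_period_dK_neg[of J E "radsq_J J", OF assms r(1) c]
      integral_phase_dK_neg[of J E "radsq_J J", OF assms r(1) c]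
      integral_period_dK_neg[of J E "radsq_E E", OF assms r(2) c']
      phase_integral_pos[of J E "radsq_E E", OF assms r(2)]
      integral_phase_dK_lower[of J E "radsq_E E", OF assms r(2)] by simp_all
  have KJ: "(kernel_integral period_kernel (radsq_J J) has_real_derivative A) (at ?m)"
    "(kernel_integral phase_kernel (radsq_J J) has_real_derivative B) (at ?m)"
    unfolding A_B_A'_B'_G_def half[symmetric]
    using m sq dJ dJc by (intro period.kernel_integral_has_derivative phase.kernel_integral_has_derivative; simp)+
  have KE: "(kernel_integral period_kernel (radsq_E E) has_real_derivative A') (at ?m)"
    "(kernel_integral phase_kernel (radsq_E E) has_real_derivative B') (at ?m)"
    unfolding A_B_A'_B'_G_def half[symmetric]
    using m sq dE dEc by (intro period.kernel_integral_has_derivative phase.kernel_integral_has_derivative; simp)+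
  let ?k = "2 * sqrt 2"
  have TE: "((\<lambda>e. T J e) has_real_derivative ?k * (A * mE)) (at E)"
  proof -
    have "((\<lambda>e. ?k * kernel_integral period_kernel (radsq_J J) (mid J e)) has_real_derivative ?k * (A * mE)) (at E)"
      by (intro DERIV_cmult DERIV_chain2[where f = "kernel_integral period_kernel (radsq_J J)"
            and g = "mid J"] KJ(1) mE(2))
    \<comment> \<open>The representation holds near \<open>E\<close> because the section of
      \<open>D\<close> is open, so the derivative carries over to \<open>T\<close>; the other three
      derivatives are treated likewise.\<close>
    moreover have "\<forall>\<^sub>F e in nhds E. T J e = ?k * kernel_integral period_kernel (radsq_J J) (mid J e)"
      using D_open_sections(1)[OF assms] by eventually_elim (intro T_eq_kernel_integral rad_eq)
    ultimately show ?thesis by (simp add: DERIV_cong_ev)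
  qed
  have PE: "((\<lambda>e. Psi J e) has_real_derivative - ?k * J * (B * mE)) (at E)"
  proof -
    have "((\<lambda>e. - ?k * J * kernel_integral phase_kernel (radsq_J J) (mid J e)) has_real_derivative - ?k * J * (B * mE)) (at E)"
      by (intro DERIV_cmult DERIV_chain2[where f = "kernel_integral phase_kernel (radsq_J J)"
            and g = "mid J"] KJ(2) mE(2))
    moreover have "\<forall>\<^sub>F e in nhds E. Psi J e = - ?k * J * kernel_integral phase_kernel (radsq_J J) (mid J e)"
      using D_open_sections(1)[OF assms] by eventually_elim (intro Psi_eq_kernel_integral rad_eq)
    ultimately show ?thesis by (subst DERIV_cong_ev[OF refl _ refl])
  qed
  have TJ: "((\<lambda>j. T j E) has_real_derivative ?k * (A' * (J * mJ))) (at J)"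
  proof -
    have "((\<lambda>j. ?k * kernel_integral period_kernel (radsq_E E) (mid j E)) has_real_derivative ?k * (A' * (J * mJ))) (at J)"
      by (intro DERIV_cmult DERIV_chain2[where f = "kernel_integral period_kernel (radsq_E E)"
            and g = "\<lambda>j. mid j E"] KE(1) mJ(2))
    moreover have "\<forall>\<^sub>F j in nhds J. T j E = ?k * kernel_integral period_kernel (radsq_E E) (mid j E)"
      using D_open_sections(2)[OF assms] by eventually_elim (intro T_eq_kernel_integral rad_eq)
    ultimately show ?thesis by (subst DERIV_cong_ev[OF refl _ refl])
  qed
  have PJ: "((\<lambda>j. Psi j E) has_real_derivative - ?k * (G + J * (B' * (J * mJ)))) (at J)"
  proof -
    have K': "((\<lambda>j. kernel_integral phase_kernel (radsq_E E) (mid j E)) has_real_derivative B' * (J * mJ)) (at J)"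
      by (intro DERIV_chain2[where f = "kernel_integral phase_kernel (radsq_E E)"
            and g = "\<lambda>j. mid j E"] KE(2) mJ(2))
    have "((\<lambda>j. - ?k * (j * kernel_integral phase_kernel (radsq_E E) (mid j E))) has_real_derivative - ?k * (G + J * (B' * (J * mJ)))) (at J)"
      by (rule DERIV_cmult) (use DERIV_mult[OF DERIV_ident K'] in \<open>simp add: A_B_A'_B'_G_def(5) algebra_simps\<close>)
    moreover have "\<forall>\<^sub>F j in nhds J. Psi j E = - ?k * (j * kernel_integral phase_kernel (radsq_E E) (mid j E))"
      using D_open_sections(2)[OF assms]
      by eventually_elim (use Psi_eq_kernel_integral[where \<delta> = "radsq_E E"] rad_eq(2) in \<open>simp add: mult.assoc\<close>)
    ultimately show ?thesis by (subst DERIV_cong_ev[OF refl _ refl])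
  qed
  \<comment> \<open>This is the claim that the derivative of \<open>Psi\<close> in \<open>J\<close>
    is negative. By the lower bound on \<open>B'\<close> it suffices that
    \<open>J^2 * mJ * 15 / (4 * (1 + ?m))\<close> is below 1, which is the second inequality of
    \<open>den\<close> after expressing \<open>J^2\<close> through \<open>?m\<close> and
    \<open>?d\<close>.\<close>
  have "0 < G + J * (B' * (J * mJ))"
  proof -
    have J2: "0 \<le> J^2 * mJ" using mJ by simp
    have "J^2 * mJ * (15 / (4 * (1 + ?m))) = 15 * (?m^2 - ?d^2) / (2 * ((2 + 3 * ?m)^2 - ?d^2))"
      unfolding mJ_def h(5) using m den(1) by (simp add: divide_simps) algebra
    also have "\<dots> < 1" using den by simp
    finally have "0 < G * (1 - J^2 * mJ * (15 / (4 * (1 + ?m))))" using G by (intro mult_pos_pos) auto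
    also have "\<dots> = G + J^2 * mJ * (- (15 / (4 * (1 + ?m))) * G)" by (simp add: algebra_simps)
    also have "\<dots> \<le> G + J^2 * mJ * B'" using G(2) J2 by (intro add_left_mono mult_left_mono)
    finally show ?thesis by (simp add: power2_eq_square mult_ac)
  qed
  then have "0 < 8 * (- A) * mE * (G + J * (B' * (J * mJ)))" using AB mE by (intro mult_pos_pos) auto
  moreover have "0 \<le> 8 * J^2 * mE * mJ * (- A') * (- B)" using AB mE mJ by (intro mult_nonneg_nonneg) auto
  \<comment> \<open>The first summand is the product of the diagonal entries, the second is minus
    the product of the off-diagonal ones and vanishes at \<open>J = 0\<close>; strict positivity
    therefore rests on the first.\<close>
  moreover have "Delta J E = 8 * (- A) * mE * (G + J * (B' * (J * mJ))) + 8 * J^2 * mE * mJ * (- A') * (- B)"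
  proof -
    have k2: "?k * ?k = 8" by simp
    have "Delta J E = (?k * ?k) * ((- A) * mE * (G + J * (B' * (J * mJ))) + J^2 * mE * mJ * (- A') * (- B))"
      unfolding Delta_def det_2 vector_2 DERIV_imp_deriv[OF TE] DERIV_imp_deriv[OF PE]
        DERIV_imp_deriv[OF TJ] DERIV_imp_deriv[OF PJ] by algebra
    then show ?thesis unfolding k2 by (simp add: algebra_simps)
  qed
  ultimately have "Delta J E > 0" by linarith
  with TE PE TJ PJ show ?thesis unfolding real_differentiable_def by blast
qed

end
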